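(* Let $k$ be a field and let $L\subseteq M$ be skew fields containing $k$ (as $k$-algebras). Suppose that $M$ is generated by $m$ elements as a skew field over $k$, and that the left $L$-dimension or the right $L$-dimension of $M$ is finite and equal to $d$. Then $L$ is generated as a skew field over $k$ by at most $d^2(m-1)+d$ elements.
   Context: All skew fields are unital $k$-algebras (so $k$ is central). A skew field $M\supseteq k$ is generated over $k$ by a subset $S$ if the smallest skew subfield of $M$ containing $k$ and $S$ is $M$. For skew fields $L\subseteq M$, the left (resp. right) $L$-dimension of $M$ is the rank of $M$ as a free left (resp. right) $L$-module; the two may differ. *)

theory Defs
  imports Complex_Main "HOL.Hull" "HOL-Library.FuncSet"
begin

text \<open>
  The ambient skew field \<open>M\<close> is a type of class \<open>division_ring\<close>; the ground field \<open>k\<close> and the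
  skew field \<open>L\<close> are subsets of it.
\<close>

definition skew_subfield :: "'a::division_ring set \<Rightarrow> bool" where
  "skew_subfield D \<longleftrightarrow>
     0 \<in> D \<and> 1 \<in> D \<and>
     (\<forall>x\<in>D. \<forall>y\<in>D. x - y \<in> D) \<and>
     (\<forall>x\<in>D. \<forall>y\<in>D. x * y \<in> D) \<and>
     (\<forall>x\<in>D. inverse x \<in> D)"

text \<open>A unital \<open>k\<close>-algebra structure on \<open>M\<close> amounts to \<open>k\<close> being a subfield of the centre of \<open>M\<close>;
  commutativity of \<open>k\<close> is part of centrality.\<close>

definition central_subfield :: "'a::division_ring set \<Rightarrow> bool" where
  "central_subfield K \<longleftrightarrow> skew_subfield K \<and> (\<forall>c\<in>K. \<forall>x. c * x = x * c)"

text \<open>When \<open>S\<close> is contained in a skew subfield \<open>D \<supseteq> K\<close>, the smallest skew subfield containing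
  \<open>K \<union> S\<close> is the same whether computed in \<open>D\<close> or in the whole type.\<close>

definition skew_generates :: "'a::division_ring set \<Rightarrow> 'a set \<Rightarrow> 'a set \<Rightarrow> bool" where
  "skew_generates K S D \<longleftrightarrow> skew_subfield hull (K \<union> S) = D"

definition left_basis :: "'a::division_ring set \<Rightarrow> 'a set \<Rightarrow> bool" where
  "left_basis L B \<longleftrightarrow> finite B \<and>
     (\<forall>x. \<exists>c \<in> B \<rightarrow> L. x = (\<Sum>b\<in>B. c b * b)) \<and>
     (\<forall>c \<in> B \<rightarrow> L. (\<Sum>b\<in>B. c b * b) = 0 \<longrightarrow> (\<forall>b\<in>B. c b = 0))"

definition right_basis :: "'a::division_ring set \<Rightarrow> 'a set \<Rightarrow> bool" where
  "right_basis L B \<longleftrightarrow> finite B \<and>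
     (\<forall>x. \<exists>c \<in> B \<rightarrow> L. x = (\<Sum>b\<in>B. b * c b)) \<and>
     (\<forall>c \<in> B \<rightarrow> L. (\<Sum>b\<in>B. b * c b) = 0 \<longrightarrow> (\<forall>b\<in>B. c b = 0))"

text \<open>\<open>left_dimension L d\<close>: the whole type is a free left \<open>L\<close>-module of finite rank \<open>d\<close>.
  All bases over a skew field have the same cardinality, so \<open>d\<close> is determined by \<open>L\<close>.\<close>

definition left_dimension :: "'a::division_ring set \<Rightarrow> nat \<Rightarrow> bool" where
  "left_dimension L d \<longleftrightarrow> (\<exists>B. left_basis L B \<and> card B = d)"

definition right_dimension :: "'a::division_ring set \<Rightarrow> nat \<Rightarrow> bool" where
  "right_dimension L d \<longleftrightarrow> (\<exists>B. right_basis L B \<and> card B = d)"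

end

theory Submission
  imports Defs
begin

text \<open>
  Grow a left \<open>L\<close>-basis \<open>E\<close> of \<open>M\<close> from \<open>1\<close> like a Schreier tree: every new basis vector is a product
  \<open>e * g j\<close> of an old one with a generator. This cannot stop early, because a finite-dimensional
  left subspace \<open>W \<noteq> 0\<close> with \<open>W * g j \<subseteq> W\<close> for all \<open>j\<close> is stable under right multiplication by the
  skew field generated by the \<open>g j\<close>. Of the \<open>d * m\<close> products \<open>e * g j\<close>, the \<open>d - 1\<close> tree edges are
  basis vectors, and the remaining \<open>d * m - (d - 1)\<close> have \<open>d\<close> coordinates each. The skew field \<open>F\<close>
  generated by these \<open>d\<^sup>2 * (m - 1) + d\<close> coordinates is \<open>L\<close>: the left \<open>F\<close>-span of \<open>E\<close> is stable
  under the \<open>g j\<close>, hence is \<open>M\<close>, and comparing \<open>1\<close>-coordinates of \<open>l \<in> L\<close> yields \<open>l \<in> F\<close>.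
\<close>

section \<open>Skew subfields\<close>

lemma skew_subfieldD:
  assumes "skew_subfield D"
  shows skew_subfield_0: "0 \<in> D" and skew_subfield_1: "1 \<in> D"
    and skew_subfield_diff: "\<And>x y. x \<in> D \<Longrightarrow> y \<in> D \<Longrightarrow> x - y \<in> D"
    and skew_subfield_mult: "\<And>x y. x \<in> D \<Longrightarrow> y \<in> D \<Longrightarrow> x * y \<in> D"
    and skew_subfield_inverse: "\<And>x. x \<in> D \<Longrightarrow> inverse x \<in> D"
  using assms unfolding skew_subfield_def by auto

lemma skew_subfield_minus: "skew_subfield D \<Longrightarrow> x \<in> D \<Longrightarrow> - x \<in> D"
  using skew_subfield_diff[of D 0 x] skew_subfield_0[of D] by simp

lemma skew_subfield_add: "skew_subfield D \<Longrightarrow> x \<in> D \<Longrightarrow> y \<in> D \<Longrightarrow> x + y \<in> D"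
  using skew_subfield_diff[of D x "- y"] skew_subfield_minus[of D y] by simp

lemma skew_subfield_hull: "skew_subfield (skew_subfield hull S)"
  by (rule hull_in) (auto simp: skew_subfield_def)

section \<open>Left linear algebra over a skew subfield\<close>

definition lsubspace :: "'a::division_ring set \<Rightarrow> 'a set \<Rightarrow> bool" where
  "lsubspace F W \<longleftrightarrow>
     0 \<in> W \<and> (\<forall>x\<in>W. \<forall>y\<in>W. x + y \<in> W) \<and> (\<forall>c\<in>F. \<forall>x\<in>W. c * x \<in> W)"

text \<open>As a hull, a span can be bounded by exhibiting any subspace that contains
  \<open>S\<close>; coefficient families are needed only where actual coordinates matter.\<close>

definition lspan :: "'a::division_ring set \<Rightarrow> 'a set \<Rightarrow> 'a set" where
  "lspan F S = lsubspace F hull S"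

definition lindep :: "'a::division_ring set \<Rightarrow> 'a set \<Rightarrow> bool" where
  "lindep F I \<longleftrightarrow> (\<forall>x\<in>I. x \<notin> lspan F (I - {x}))"

lemma lsubspace_lspan: "lsubspace F (lspan F S)"
  unfolding lspan_def by (rule hull_in) (auto simp: lsubspace_def)

lemma lspan_0: "0 \<in> lspan F S"
  and lspan_add: "x \<in> lspan F S \<Longrightarrow> y \<in> lspan F S \<Longrightarrow> x + y \<in> lspan F S"
  and lspan_scale: "c \<in> F \<Longrightarrow> x \<in> lspan F S \<Longrightarrow> c * x \<in> lspan F S"
  using lsubspace_lspan[of F S] unfolding lsubspace_def by auto

lemma lspan_superset: "S \<subseteq> lspan F S"
  unfolding lspan_def by (rule hull_subset)

lemma lspan_base: "x \<in> S \<Longrightarrow> x \<in> lspan F S"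
  using lspan_superset by blast

lemma lspan_minimal: "S \<subseteq> W \<Longrightarrow> lsubspace F W \<Longrightarrow> lspan F S \<subseteq> W"
  unfolding lspan_def by (rule hull_minimal)

lemma lspan_mono: "S \<subseteq> T \<Longrightarrow> lspan F S \<subseteq> lspan F T"
  unfolding lspan_def by (rule hull_mono)

lemma lspan_mono_scalars: "F \<subseteq> G \<Longrightarrow> lspan F S \<subseteq> lspan G S"
  by (rule lspan_minimal[OF lspan_superset]) (auto simp: lsubspace_def lspan_0 lspan_add lspan_scale)

lemma lspan_trans: "S \<subseteq> lspan F T \<Longrightarrow> lspan F S \<subseteq> lspan F T"
  by (rule lspan_minimal[OF _ lsubspace_lspan])

lemma lspan_sum:
  assumes "c \<in> S \<rightarrow> F"
  shows "(\<Sum>s\<in>S. c s * s) \<in> lspan F S"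
proof -
  have "(\<Sum>s\<in>A. c s * s) \<in> lspan F S" if "A \<subseteq> S" for A
    using that assms
    by (induction A rule: infinite_finite_induct)
      (auto simp: lspan_0 intro: lspan_add lspan_scale lspan_base)
  then show ?thesis by blast
qed

text \<open>Links the hull to the coefficient sums in \<open>left_basis\<close>: these sums form a
  subspace containing \<open>S\<close>, so minimality applies.\<close>

lemma lspan_finite_eq:
  assumes F: "skew_subfield F" and S: "finite S"
  shows "lspan F S = {x. \<exists>c \<in> S \<rightarrow> F. x = (\<Sum>s\<in>S. c s * s)}" (is "_ = ?W")
proof
  have "lsubspace F ?W"
    unfolding lsubspace_def
  proof (intro conjI ballI)
    show "0 \<in> ?W"
      using skew_subfield_0[OF F] by (auto intro!: bexI[of _ "\<lambda>_. 0"])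
  next
    fix x y assume "x \<in> ?W" "y \<in> ?W"
    then obtain c c' where c: "c \<in> S \<rightarrow> F" "c' \<in> S \<rightarrow> F"
      and xy: "x = (\<Sum>s\<in>S. c s * s)" "y = (\<Sum>s\<in>S. c' s * s)" by blast
    have "x + y = (\<Sum>s\<in>S. (c s + c' s) * s)"
      by (simp add: xy sum.distrib distrib_right)
    moreover have "(\<lambda>s. c s + c' s) \<in> S \<rightarrow> F"
      using c skew_subfield_add[OF F] by auto
    ultimately show "x + y \<in> ?W" unfolding mem_Collect_eq by (rule bexI)
  next
    fix a x assume a: "a \<in> F" and "x \<in> ?W"
    then obtain c where c: "c \<in> S \<rightarrow> F" and x: "x = (\<Sum>s\<in>S. c s * s)" by blast
    have "a * x = (\<Sum>s\<in>S. (a * c s) * s)"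
      by (simp add: x sum_distrib_left mult.assoc)
    moreover have "(\<lambda>s. a * c s) \<in> S \<rightarrow> F"
      using a c skew_subfield_mult[OF F] by auto
    ultimately show "a * x \<in> ?W" unfolding mem_Collect_eq by (rule bexI)
  qed
  moreover have "S \<subseteq> ?W"
  proof
    fix t assume t: "t \<in> S"
    have "t = (\<Sum>s\<in>S. (if s = t then 1 else 0) * s)"
      using t S by (simp add: if_distrib[of "\<lambda>c. c * _"] cong: if_cong)
    moreover have "(\<lambda>s. if s = t then 1 else 0) \<in> S \<rightarrow> F"
      using skew_subfield_0[OF F] skew_subfield_1[OF F] by auto
    ultimately show "t \<in> ?W" unfolding mem_Collect_eq by (rule bexI)
  qed
  ultimately show "lspan F S \<subseteq> ?W" by (rule lspan_minimal[rotated])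
  show "?W \<subseteq> lspan F S" using lspan_sum by blast
qed

lemma lspan_minus: "skew_subfield F \<Longrightarrow> x \<in> lspan F S \<Longrightarrow> - x \<in> lspan F S"
  using lspan_scale[of "- 1" F x S] skew_subfield_minus[of F 1] skew_subfield_1[of F] by simp

lemma lspan_diff: "skew_subfield F \<Longrightarrow> x \<in> lspan F S \<Longrightarrow> y \<in> lspan F S \<Longrightarrow> x - y \<in> lspan F S"
  using lspan_add[of x F S "- y"] lspan_minus[of F y S] by simp

text \<open>The elements that fall into \<open>lspan F S\<close> after subtracting some multiple of
  \<open>x\<close> form a subspace containing \<open>x\<close> and \<open>S\<close>.\<close>

lemma lspan_insertE:
  assumes F: "skew_subfield F" and y: "y \<in> lspan F (insert x S)"
  obtains c where "c \<in> F" "y - c * x \<in> lspan F S"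
proof -
  let ?W = "{y. \<exists>c\<in>F. y - c * x \<in> lspan F S}"
  have "lsubspace F ?W"
    unfolding lsubspace_def
  proof (intro conjI ballI)
    show "0 \<in> ?W"
      using skew_subfield_0[OF F] lspan_0 by force
  next
    fix u v assume "u \<in> ?W" "v \<in> ?W"
    then obtain c c' where c: "c \<in> F" "u - c * x \<in> lspan F S" "c' \<in> F" "v - c' * x \<in> lspan F S"
      by blast
    have "(u - c * x) + (v - c' * x) = (u + v) - (c + c') * x"
      by (simp add: algebra_simps)
    with c show "u + v \<in> ?W"
      using lspan_add skew_subfield_add[OF F] by (metis (mono_tags, lifting) mem_Collect_eq)
  next
    fix a u assume a: "a \<in> F" and "u \<in> ?W"
    then obtain c where c: "c \<in> F" "u - c * x \<in> lspan F S" by blast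
    have "a * (u - c * x) = a * u - (a * c) * x"
      by (simp add: algebra_simps)
    with a c show "a * u \<in> ?W"
      using lspan_scale skew_subfield_mult[OF F] by (metis (mono_tags, lifting) mem_Collect_eq)
  qed
  moreover have "insert x S \<subseteq> ?W"
  proof -
    have "x - 1 * x \<in> lspan F S" by (simp add: lspan_0)
    moreover have "s - 0 * x \<in> lspan F S" if "s \<in> S" for s
      using that by (simp add: lspan_base)
    ultimately show ?thesis
      using skew_subfield_0[OF F] skew_subfield_1[OF F] by blast
  qed
  ultimately have "lspan F (insert x S) \<subseteq> ?W" by (rule lspan_minimal[rotated])
  with y that show thesis by blast
qed

lemma lspan_scale_cancel:
  assumes F: "skew_subfield F" and "c \<in> F" "c \<noteq> 0" "c * x \<in> lspan F S"
  shows "x \<in> lspan F S"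
proof -
  have "inverse c * (c * x) \<in> lspan F S"
    using assms by (intro lspan_scale[OF skew_subfield_inverse[OF F]])
  then show ?thesis
    using \<open>c \<noteq> 0\<close> by (simp flip: mult.assoc)
qed

section \<open>Exchange and comparison of cardinalities\<close>

text \<open>The coefficient of \<open>x\<close> in \<open>y\<close> is nonzero, since otherwise
  \<open>y\<close> would lie in \<open>lspan F S\<close>; dividing by it solves for
  \<open>x\<close>.\<close>

lemma lspan_exchange:
  assumes F: "skew_subfield F" and y: "y \<in> lspan F (insert x S)" "y \<notin> lspan F S"
  shows "x \<in> lspan F (insert y S)"
proof -
  obtain c where c: "c \<in> F" "y - c * x \<in> lspan F S"
    using lspan_insertE[OF F y(1)] .
  have "c \<noteq> 0" using c(2) y(2) by auto
  have "y - (y - c * x) \<in> lspan F (insert y S)"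
  proof (rule lspan_diff[OF F])
    show "y \<in> lspan F (insert y S)" by (simp add: lspan_base)
    show "y - c * x \<in> lspan F (insert y S)" using c(2) lspan_mono[OF subset_insertI] by blast
  qed
  then have "c * x \<in> lspan F (insert y S)" by simp
  with c(1) \<open>c \<noteq> 0\<close> show ?thesis by (rule lspan_scale_cancel[OF F])
qed

lemma lindep_subset: "lindep F I \<Longrightarrow> J \<subseteq> I \<Longrightarrow> lindep F J"
  unfolding lindep_def by (meson Diff_mono lspan_mono order_refl subsetD)

lemma lindep_mono_scalars: "lindep G I \<Longrightarrow> F \<subseteq> G \<Longrightarrow> lindep F I"
  unfolding lindep_def using lspan_mono_scalars by blast

lemma lindep_insert:
  assumes F: "skew_subfield F" and I: "lindep F I" and s: "s \<notin> lspan F I"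
  shows "lindep F (insert s I)"
  unfolding lindep_def
proof
  fix t assume t: "t \<in> insert s I"
  have "s \<notin> I" using s lspan_base by blast
  show "t \<notin> lspan F (insert s I - {t})"
  proof (cases "t = s")
    case True
    with s \<open>s \<notin> I\<close> show ?thesis by simp
  next
    case False
    with t have "t \<in> I" by simp
    then have "t \<notin> lspan F (I - {t})" using I by (simp add: lindep_def)
    moreover have "s \<notin> lspan F (insert t (I - {t}))"
      using s \<open>t \<in> I\<close> by (simp add: insert_absorb)
    ultimately have "t \<notin> lspan F (insert s (I - {t}))"
      using lspan_exchange[OF F] by blast
    with False show ?thesis by (simp add: insert_Diff_if)
  qed
qed

text \<open>Steinitz replacement: an element of \<open>I\<close> outside \<open>S\<close> is traded
  for one of \<open>S\<close>, keeping independence and cardinality, until \<open>I\<close> lies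
  inside \<open>S\<close>.\<close>

lemma lindep_card_le:
  assumes F: "skew_subfield F" and S: "finite S"
    and "finite I" "lindep F I" "I \<subseteq> lspan F S"
  shows "card I \<le> card S"
  using assms(3-5)
proof (induction "card (I - S)" arbitrary: I)
  case 0
  then have "I \<subseteq> S" by auto
  then show ?case using S by (simp add: card_mono)
next
  case (Suc n)
  then obtain a where a: "a \<in> I" "a \<notin> S"
    by (metis DiffE card.empty ex_in_conv nat.distinct(1))
  have "a \<notin> lspan F (I - {a})"
    using Suc.prems a by (simp add: lindep_def)
  \<comment> \<open>Otherwise all of \<open>lspan F S\<close>, and with it \<open>a\<close>, would
    lie in the span of the remaining elements.\<close>
  then have "\<not> S \<subseteq> lspan F (I - {a})"
    using Suc.prems(3) a(1) lspan_trans by blast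
  then obtain s where s: "s \<in> S" "s \<notin> lspan F (I - {a})" by blast
  let ?J = "insert s (I - {a})"
  have "s \<notin> I - {a}" using s(2) lspan_base[of s "I - {a}" F] by blast
  then have card: "card ?J = card I"
    using Suc.prems(1) a(1) by (metis card.insert card.remove finite_Diff)
  have "?J - S = (I - S) - {a}" using s(1) by blast
  then have "n = card (?J - S)"
    using Suc.hyps(2) Suc.prems(1) a by simp
  moreover have "lindep F ?J"
    by (rule lindep_insert[OF F lindep_subset[OF Suc.prems(2)] s(2)]) blast
  moreover have "?J \<subseteq> lspan F S"
    using Suc.prems(3) s(1) lspan_base by auto
  ultimately have "card ?J \<le> card S"
    using Suc.hyps(1) Suc.prems(1) by blast
  then show ?case using card by simp
qed

text \<open>A vector of \<open>lspan F S\<close> outside \<open>lspan F I\<close> would enlarge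
  \<open>I\<close> to an independent set with more than \<open>card S\<close> elements.\<close>

lemma lindep_card_eq_imp_spans:
  assumes F: "skew_subfield F" and "finite S" "finite I" "lindep F I" "I \<subseteq> lspan F S"
    and card: "card I = card S"
  shows "lspan F S \<subseteq> lspan F I"
proof
  fix x assume x: "x \<in> lspan F S"
  show "x \<in> lspan F I"
  proof (rule ccontr)
    assume nx: "x \<notin> lspan F I"
    then have "card (insert x I) \<le> card S"
      using assms x by (intro lindep_card_le[OF F] lindep_insert[OF F]) auto
    moreover have "x \<notin> I" using nx lspan_base by blast
    ultimately show False using card \<open>finite I\<close> by simp
  qed
qed

section \<open>Right multiplication as a left linear map\<close>

lemma lspan_mult_right_image:
  assumes "skew_subfield F"
  shows "lspan F ((\<lambda>e. e * x) ` S) = (\<lambda>e. e * x) ` lspan F S"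
proof
  have "lsubspace F ((\<lambda>e. e * x) ` lspan F S)"
    unfolding lsubspace_def
  proof (intro conjI ballI)
    show "0 \<in> (\<lambda>e. e * x) ` lspan F S"
      using lspan_0 by (rule rev_image_eqI) simp
  next
    fix u v assume "u \<in> (\<lambda>e. e * x) ` lspan F S" "v \<in> (\<lambda>e. e * x) ` lspan F S"
    then obtain e e' where "e \<in> lspan F S" "e' \<in> lspan F S" "u = e * x" "v = e' * x" by blast
    then show "u + v \<in> (\<lambda>e. e * x) ` lspan F S"
      by (intro image_eqI[of _ _ "e + e'"] lspan_add) (auto simp: distrib_right)
  next
    fix a u assume "a \<in> F" "u \<in> (\<lambda>e. e * x) ` lspan F S"
    then obtain e where "a \<in> F" "e \<in> lspan F S" "u = e * x" by blast
    then show "a * u \<in> (\<lambda>e. e * x) ` lspan F S"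
      by (intro image_eqI[of _ _ "a * e"] lspan_scale) (auto simp: mult.assoc)
  qed
  then show "lspan F ((\<lambda>e. e * x) ` S) \<subseteq> (\<lambda>e. e * x) ` lspan F S"
    using lspan_superset by (intro lspan_minimal) auto
  have "lsubspace F {e. e * x \<in> lspan F ((\<lambda>e. e * x) ` S)}"
    by (auto simp: lsubspace_def lspan_0 distrib_right mult.assoc intro: lspan_add lspan_scale)
  then have "lspan F S \<subseteq> {e. e * x \<in> lspan F ((\<lambda>e. e * x) ` S)}"
    by (intro lspan_minimal) (auto intro: lspan_base)
  then show "(\<lambda>e. e * x) ` lspan F S \<subseteq> lspan F ((\<lambda>e. e * x) ` S)" by blast
qed

lemma lindep_mult_right_image:
  assumes F: "skew_subfield F" and I: "lindep F I" and x: "x \<noteq> 0"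
  shows "lindep F ((\<lambda>e. e * x) ` I)"
  unfolding lindep_def
proof
  fix y assume "y \<in> (\<lambda>e. e * x) ` I"
  then obtain e where e: "e \<in> I" "y = e * x" by blast
  have "(\<lambda>e. e * x) ` I - {y} = (\<lambda>e. e * x) ` (I - {e})"
    using x e by auto
  then have "lspan F ((\<lambda>e. e * x) ` I - {y}) = (\<lambda>e. e * x) ` lspan F (I - {e})"
    using lspan_mult_right_image[OF F] by simp
  then show "y \<notin> lspan F ((\<lambda>e. e * x) ` I - {y})"
    using I e x by (auto simp: lindep_def)
qed

text \<open>Right multiplication by \<open>x \<noteq> 0\<close> is left linear and injective, so a finite-dimensional left
  subspace \<open>W\<close> with \<open>W * x \<subseteq> W\<close> satisfies \<open>W * x = W\<close>; the right stabiliser of \<open>W\<close> is therefore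
  closed under inverses.\<close>

lemma lspan_stable_eq_UNIV:
  assumes F: "skew_subfield F" and K: "central_subfield K" "K \<subseteq> F"
    and gen: "skew_generates K G UNIV"
    and E: "finite E" "lindep F E" "1 \<in> E"
    and stable: "\<And>e x. e \<in> E \<Longrightarrow> x \<in> G \<Longrightarrow> e * x \<in> lspan F E"
  shows "lspan F E = UNIV"
proof -
  let ?W = "lspan F E"
  let ?R = "{x. \<forall>w\<in>?W. w * x \<in> ?W}"
  have "skew_subfield ?R"
    unfolding skew_subfield_def
  proof (intro conjI ballI)
    show "0 \<in> ?R" "1 \<in> ?R" by (auto simp: lspan_0)
  next
    fix x y assume "x \<in> ?R" "y \<in> ?R"
    then show "x - y \<in> ?R" "x * y \<in> ?R"
      by (auto simp: right_diff_distrib lspan_diff[OF F] simp flip: mult.assoc)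
  next
    fix x assume x: "x \<in> ?R"
    show "inverse x \<in> ?R"
    proof (cases "x = 0")
      case True
      with x show ?thesis by simp
    next
      case False
      let ?f = "\<lambda>e. e * x"
      have "inj_on ?f E" using False by (auto intro: inj_onI)
      then have "card (?f ` E) = card E" by (rule card_image)
      moreover have "?f ` E \<subseteq> ?W" using x lspan_base by auto
      ultimately have "?W \<subseteq> lspan F (?f ` E)"
        using lindep_mult_right_image[OF F E(2) False] E(1)
        by (intro lindep_card_eq_imp_spans[OF F]) auto
      then have sub: "?W \<subseteq> ?f ` ?W" by (simp add: lspan_mult_right_image[OF F])
      have "w * inverse x \<in> ?W" if w: "w \<in> ?W" for w
      proof -
        obtain v where "v \<in> ?W" "w = v * x" using subsetD[OF sub w] by blast
        then show ?thesis using False by (simp add: mult.assoc)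
      qed
      then show ?thesis by simp
    qed
  qed
  moreover have "K \<subseteq> ?R"
  proof
    fix c assume "c \<in> K"
    \<comment> \<open>Centrality turns right multiplication by \<open>c\<close> into left scaling by
      an element of \<open>F\<close>.\<close>
    then have "c \<in> F" and "c * w = w * c" for w
      using K by (auto simp: central_subfield_def)
    then have "w * c \<in> ?W" if "w \<in> ?W" for w
      using lspan_scale[of c F w E] that by metis
    then show "c \<in> ?R" by blast
  qed
  moreover have "G \<subseteq> ?R"
  proof
    fix x assume x: "x \<in> G"
    have "(\<lambda>e. e * x) ` ?W = lspan F ((\<lambda>e. e * x) ` E)"
      by (rule lspan_mult_right_image[OF F, symmetric])
    also have "\<dots> \<subseteq> ?W" using stable x by (intro lspan_trans) auto
    finally show "x \<in> ?R" by blast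
  qed
  ultimately have "skew_subfield hull (K \<union> G) \<subseteq> ?R"
    by (intro hull_minimal) auto
  then have R: "?R = UNIV" using gen unfolding skew_generates_def by blast
  have "1 * x \<in> ?W" for x
    using R lspan_base[OF E(3), of F] by blast
  then show ?thesis by auto
qed

section \<open>Bases as independent spanning sets\<close>

lemma left_basis_lspan:
  assumes "skew_subfield L" "left_basis L B"
  shows "lspan L B = UNIV"
  using assms unfolding left_basis_def by (auto simp: lspan_finite_eq)

lemma left_basis_lindep:
  assumes L: "skew_subfield L" and B: "left_basis L B"
  shows "lindep L B"
  unfolding lindep_def
proof (intro ballI notI)
  fix x assume x: "x \<in> B" and "x \<in> lspan L (B - {x})"
  have fin: "finite B" using B by (simp add: left_basis_def)
  then obtain c where c: "c \<in> (B - {x}) \<rightarrow> L" and xc: "x = (\<Sum>b\<in>B - {x}. c b * b)"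
    using \<open>x \<in> lspan L (B - {x})\<close> lspan_finite_eq[OF L, of "B - {x}"] by auto
  \<comment> \<open>Moving \<open>x\<close> to the other side of its expansion gives a vanishing sum
    whose coefficient at \<open>x\<close> is visibly nonzero.\<close>
  let ?c = "c(x := - 1)"
  have "?c \<in> B \<rightarrow> L"
    using c skew_subfield_minus[OF L skew_subfield_1[OF L]] by auto
  moreover have "(\<Sum>b\<in>B. ?c b * b) = ?c x * x + (\<Sum>b\<in>B - {x}. ?c b * b)"
    using fin x by (rule sum.remove)
  moreover have "(\<Sum>b\<in>B - {x}. ?c b * b) = x"
    by (subst (2) xc) (rule sum.cong, auto)
  ultimately have "?c \<in> B \<rightarrow> L" "(\<Sum>b\<in>B. ?c b * b) = 0" by simp_all
  then have "?c x = 0" using B x unfolding left_basis_def by blast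
  then show False by simp
qed

section \<open>The Schreier basis\<close>

text \<open>A tree of greatest size is stable under the generators, since a product outside its span
  could be attached as a new leaf. Stability makes it span everything.\<close>

lemma schreier_basis:
  fixes g :: "nat \<Rightarrow> 'a::division_ring"
  assumes K: "central_subfield K" "K \<subseteq> L" and L: "skew_subfield L"
    and gen: "skew_generates K (g ` {..<m}) UNIV"
    and B: "left_basis L B"
  obtains E P where "finite E" "1 \<in> E" "lindep L E" "card E = card B" "lspan L E = UNIV"
    "P \<subseteq> E \<times> {..<m}" "Suc (card P) = card E" "\<And>e j. (e, j) \<in> P \<Longrightarrow> e * g j \<in> E"
proof -
  \<comment> \<open>A pair \<open>(e, j)\<close> in \<open>P\<close> is the edge from
    \<open>e\<close> to \<open>e * g j\<close>. Of the tree structure only the root \<open>1\<close>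
    and the count are kept: one edge fewer than vertices.\<close>
  define tree where "tree E P \<longleftrightarrow> finite E \<and> 1 \<in> E \<and> lindep L E \<and> P \<subseteq> E \<times> {..<m} \<and>
      Suc (card P) = card E \<and> (\<forall>(e, j)\<in>P. e * g j \<in> E)" for E P
  have finB: "finite B" using B by (simp add: left_basis_def)
  have spanB: "lspan L B = UNIV" by (rule left_basis_lspan[OF L B])
  have bound: "card E \<le> card B" if "tree E P" for E P
    using that by (intro lindep_card_le[OF L finB]) (auto simp: tree_def spanB)
  have "(1::'a) \<notin> lspan L {}"
    using lspan_minimal[of "{}" "{0}" L] by (auto simp: lsubspace_def)
  then have "tree {1} {}"
    by (simp add: tree_def lindep_def)
  define size where "size n \<longleftrightarrow> (\<exists>E P. tree E P \<and> card E = n)" for n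
  define n where "n = Greatest size"
  \<comment> \<open>This bound makes \<open>Greatest\<close> meaningful.\<close>
  have size_le: "k \<le> card B" if "size k" for k
    using that bound unfolding size_def by blast
  have "\<exists>k. size k" using \<open>tree {1} {}\<close> unfolding size_def by blast
  then have "size n" unfolding n_def using size_le by (rule GreatestI_ex_nat)
  then obtain E P where t: "tree E P" and n: "card E = n" unfolding size_def by blast
  have max: "card E' \<le> n" if "tree E' P'" for E' P'
    unfolding n_def using that size_le by (intro Greatest_le_nat[of size]) (auto simp: size_def)
  have "e * x \<in> lspan L E" if e: "e \<in> E" and "x \<in> g ` {..<m}" for e x
  proof (rule ccontr)
    obtain j where j: "j < m" and x: "x = g j" using \<open>x \<in> g ` {..<m}\<close> by blast
    assume new: "e * x \<notin> lspan L E"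
    then have nE: "e * g j \<notin> E" using lspan_base x by blast
    \<comment> \<open>The edge is new because its endpoint is, so vertex and edge counts both grow
      by exactly one.\<close>
    then have nP: "(e, j) \<notin> P" using t unfolding tree_def by blast
    have finP: "finite P"
      using t finite_subset[of P "E \<times> {..<m}"] by (auto simp: tree_def)
    have "lindep L (insert (e * x) E)"
      using lindep_insert[OF L _ new] t by (simp add: tree_def)
    then have "tree (insert (e * g j) E) (insert (e, j) P)"
      using t nE nP finP e j x unfolding tree_def by auto
    then have "card (insert (e * g j) E) \<le> n" using max by blast
    moreover have "finite E" using t by (simp add: tree_def)
    ultimately show False using nE n by simp
  qed
  then have span: "lspan L E = UNIV"
    using t by (intro lspan_stable_eq_UNIV[OF L K gen]) (auto simp: tree_def)
  have "card B \<le> card E"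
    using t finB span left_basis_lindep[OF L B]
    by (intro lindep_card_le[OF L]) (auto simp: tree_def)
  with bound[OF t] have "card E = card B" by simp
  with t span show thesis
    by (intro that[of E P]) (auto simp: tree_def)
qed

section \<open>Coordinates of the non-tree products generate \<open>L\<close>\<close>

text \<open>Integer arithmetic keeps the bound right for \<open>m = 0\<close>: then \<open>K\<close>
  and \<open>L\<close> are the whole skew field, \<open>d = 1\<close>, and the bound is
  \<open>0\<close>.\<close>

lemma left_dimension_generators:
  fixes K L :: "'a::division_ring set" and g :: "nat \<Rightarrow> 'a"
  assumes K: "central_subfield K" and L: "skew_subfield L" and KL: "K \<subseteq> L"
    and gen: "skew_generates K (g ` {..<m}) UNIV"
    and "left_dimension L d"
  shows "\<exists>T. finite T \<and> int (card T) \<le> (int d)\<^sup>2 * (int m - 1) + int d \<and> skew_generates K T L"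
proof -
  obtain B where B: "left_basis L B" "card B = d"
    using \<open>left_dimension L d\<close> unfolding left_dimension_def by blast
  obtain E P where E: "finite E" "1 \<in> E" "lindep L E" "card E = card B" "lspan L E = UNIV"
    and P: "P \<subseteq> E \<times> {..<m}" "Suc (card P) = card E" "\<And>e j. (e, j) \<in> P \<Longrightarrow> e * g j \<in> E"
    using schreier_basis[OF K KL L gen B(1)] by metis
  have "\<forall>x. \<exists>c \<in> E \<rightarrow> L. x = (\<Sum>b\<in>E. c b * b)"
    using E(5) lspan_finite_eq[OF L E(1)] by auto
  then obtain coord where coord: "\<And>x. coord x \<in> E \<rightarrow> L" "\<And>x. x = (\<Sum>b\<in>E. coord x b * b)"
    by metis
  define Q where "Q = E \<times> {..<m} - P"
  \<comment> \<open>Tree edges contribute nothing to \<open>T\<close>: their products already lie in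
    \<open>E\<close>.\<close>
  define T where "T = (\<lambda>((e, j), b). coord (e * g j) b) ` (Q \<times> E)"
  define F where "F = skew_subfield hull (K \<union> T)"
  have finP: "finite P" using P(1) E(1) finite_subset by blast
  have finQ: "finite Q" unfolding Q_def using E(1) by blast
  have "card Q = d * m - card P" "card P \<le> d * m"
    using P(1) E(1,4) B(2) finP card_mono[OF _ P(1)] by (auto simp: Q_def card_Diff_subset)
  then have "int (card Q) = int d * int m - (int d - 1)"
    using P(2) E(4) B(2) by (simp add: of_nat_diff)
  moreover have "card T \<le> card Q * d"
    unfolding T_def using card_image_le[of "Q \<times> E"] finQ E(1,4) B(2)
    by (metis card_cartesian_product finite_cartesian_product)
  then have "int (card T) \<le> int (card Q) * int d"
    by (metis of_nat_le_iff of_nat_mult)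
  ultimately have "int (card T) \<le> (int d * int m - (int d - 1)) * int d" by simp
  also have "\<dots> = (int d)\<^sup>2 * (int m - 1) + int d"
    by (simp add: algebra_simps power2_eq_square)
  finally have bound: "int (card T) \<le> (int d)\<^sup>2 * (int m - 1) + int d" .
  have F: "skew_subfield F" unfolding F_def by (rule skew_subfield_hull)
  have KTF: "K \<union> T \<subseteq> F" unfolding F_def by (rule hull_subset)
  have "T \<subseteq> L" using coord(1) unfolding T_def by auto
  then have FL: "F \<subseteq> L" unfolding F_def using KL L by (intro hull_minimal) auto
  have "e * x \<in> lspan F E" if e: "e \<in> E" and "x \<in> g ` {..<m}" for e x
  proof -
    obtain j where j: "j < m" and x: "x = g j" using \<open>x \<in> g ` {..<m}\<close> by blast
    show ?thesis
    proof (cases "(e, j) \<in> P")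
      case True
      then show ?thesis using P(3) x lspan_base by blast
    next
      case False
      then have "(e, j) \<in> Q" using e j by (simp add: Q_def)
      then have "coord (e * g j) b \<in> T" if "b \<in> E" for b
        unfolding T_def using that by (intro image_eqI[of _ _ "((e, j), b)"]) auto
      then have "coord (e * g j) \<in> E \<rightarrow> F" using KTF by blast
      then have "(\<Sum>b\<in>E. coord (e * g j) b * b) \<in> lspan F E" by (rule lspan_sum)
      then show ?thesis using coord(2)[of "e * g j"] x by simp
    qed
  qed
  \<comment> \<open>Independence over \<open>L\<close> passes down to \<open>F\<close>, so the
    stability criterion applies over the smaller skew field.\<close>
  then have span: "lspan F E = UNIV"
    using KTF E lindep_mono_scalars[OF E(3) FL]
    by (intro lspan_stable_eq_UNIV[OF F K _ gen]) auto
  have "L \<subseteq> F"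
  proof
    fix l assume l: "l \<in> L"
    \<comment> \<open>Splitting off the \<open>1\<close>-coordinate \<open>c\<close> of
      \<open>l\<close> over \<open>F\<close> leaves \<open>l - c\<close> in the
      \<open>L\<close>-span of the other basis vectors. If \<open>l - c\<close> were nonzero,
      dividing by it would put \<open>1\<close> there, against independence.\<close>
    have "l \<in> lspan F (insert 1 (E - {1}))"
      using span E(2) by (simp add: insert_absorb)
    then obtain c where c: "c \<in> F" "l - c * 1 \<in> lspan F (E - {1})"
      by (rule lspan_insertE[OF F])
    then have "(l - c) * 1 \<in> lspan L (E - {1})"
      using lspan_mono_scalars[OF FL] by auto
    moreover have "1 \<notin> lspan L (E - {1})"
      using E(2,3) by (simp add: lindep_def)
    moreover have "l - c \<in> L"
      using l c(1) FL skew_subfield_diff[OF L] by blast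
    ultimately have "l - c = 0"
      using lspan_scale_cancel[OF L] by blast
    then show "l \<in> F" using c(1) by simp
  qed
  with FL have "skew_generates K T L"
    by (simp add: skew_generates_def F_def)
  moreover have "finite T" unfolding T_def using finQ E(1) by simp
  ultimately show ?thesis using bound by blast
qed

section \<open>The opposite skew field\<close>

text \<open>A separate type is used because a type carries only one multiplication; reversing the
  product turns right modules into left ones.\<close>

datatype 'a opp = Opp (unopp: 'a)

lemma eq_Opp_iff: "x = Opp y \<longleftrightarrow> unopp x = y"
  by (cases x) auto

instantiation opp :: (division_ring) division_ring
begin

definition "0 = Opp 0"
definition "1 = Opp 1"
definition "x + y = Opp (unopp x + unopp y)"
definition "x - y = Opp (unopp x - unopp y)"
definition "- x = Opp (- unopp x)"
definition "x * y = Opp (unopp y * unopp x)"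
definition "inverse x = Opp (inverse (unopp x))"
text \<open>This is \<open>x * inverse y\<close> in the opposite product, hence the inverse on the
  left.\<close>

definition "x div y = Opp (inverse (unopp y) * unopp x)"

lemmas opp_defs = zero_opp_def one_opp_def plus_opp_def minus_opp_def uminus_opp_def
  times_opp_def inverse_opp_def divide_opp_def

instance
  by standard (auto simp: opp_defs algebra_simps eq_Opp_iff)

end

lemma inj_Opp: "inj Opp"
  by (auto intro: injI)

lemma Opp_image_iff: "x \<in> Opp ` D \<longleftrightarrow> unopp x \<in> D"
  by (cases x) auto

lemma Opp_image_unopp: "Opp ` unopp ` D = D"
  by (auto simp: image_image)

lemma Opp_sum: "Opp (\<Sum>x\<in>A. f x) = (\<Sum>x\<in>A. Opp (f x))"
  using sum_comp_morphism[of Opp f A] by (simp add: zero_opp_def plus_opp_def comp_def)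

lemma skew_subfield_Opp: "skew_subfield (Opp ` D) \<longleftrightarrow> skew_subfield D"
  unfolding skew_subfield_def by (auto simp: Opp_image_iff opp_defs)

text \<open>\<open>Opp\<close> and \<open>unopp\<close> both preserve skew subfields, because
  closure under products does not see the order of the factors; minimality then applies in both
  directions.\<close>

lemma hull_Opp: "skew_subfield hull (Opp ` S) = Opp ` (skew_subfield hull S)"
proof
  show "skew_subfield hull (Opp ` S) \<subseteq> Opp ` (skew_subfield hull S)"
    by (rule hull_minimal) (auto simp: skew_subfield_Opp skew_subfield_hull intro: hull_inc)
  have "skew_subfield (unopp ` (skew_subfield hull (Opp ` S)))"
    by (subst skew_subfield_Opp[symmetric]) (simp add: Opp_image_unopp skew_subfield_hull)
  moreover have "S \<subseteq> unopp ` (skew_subfield hull (Opp ` S))"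
    by (metis hull_inc image_eqI opp.sel subsetI)
  ultimately have "skew_subfield hull S \<subseteq> unopp ` (skew_subfield hull (Opp ` S))"
    by (rule hull_minimal[rotated])
  then have "Opp ` (skew_subfield hull S) \<subseteq> Opp ` unopp ` (skew_subfield hull (Opp ` S))"
    by (rule image_mono)
  then show "Opp ` (skew_subfield hull S) \<subseteq> skew_subfield hull (Opp ` S)"
    by (simp only: Opp_image_unopp)
qed

lemma skew_generates_Opp: "skew_generates (Opp ` K) (Opp ` S) (Opp ` D) \<longleftrightarrow> skew_generates K S D"
  unfolding skew_generates_def by (simp add: hull_Opp inj_image_eq_iff[OF inj_Opp] flip: image_Un)

lemma central_subfield_Opp: "central_subfield K \<Longrightarrow> central_subfield (Opp ` K)"
  unfolding central_subfield_def by (auto simp: skew_subfield_Opp times_opp_def)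

text \<open>\<open>Opp\<close> turns each term \<open>b * c b\<close> into one with its scalar on
  the left, so spanning and independence transfer coefficientwise.\<close>

lemma right_basis_Opp:
  assumes "right_basis L B"
  shows "left_basis (Opp ` L) (Opp ` B)"
proof -
  have sum: "(\<Sum>b\<in>Opp ` B. c b * b) = Opp (\<Sum>b\<in>B. b * unopp (c (Opp b)))" for c
    by (simp add: sum.reindex[OF inj_on_subset[OF inj_Opp subset_UNIV]] Opp_sum times_opp_def)
  show ?thesis
    unfolding left_basis_def sum
  proof (intro conjI allI ballI impI)
    show "finite (Opp ` B)" using assms by (simp add: right_basis_def)
  next
    fix x :: "'a opp"
    obtain c where "c \<in> B \<rightarrow> L" "unopp x = (\<Sum>b\<in>B. b * c b)"
      using assms unfolding right_basis_def by blast
    then show "\<exists>c\<in>Opp ` B \<rightarrow> Opp ` L. x = Opp (\<Sum>b\<in>B. b * unopp (c (Opp b)))"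
      by (intro bexI[of _ "\<lambda>b. Opp (c (unopp b))"]) (auto intro: opp.expand)
  next
    fix c b assume c: "c \<in> Opp ` B \<rightarrow> Opp ` L"
      and 0: "Opp (\<Sum>b\<in>B. b * unopp (c (Opp b))) = 0" and b: "b \<in> Opp ` B"
    have "(\<lambda>b. unopp (c (Opp b))) \<in> B \<rightarrow> L"
      using c by (auto simp: Pi_iff Opp_image_iff)
    moreover have "(\<Sum>b\<in>B. b * unopp (c (Opp b))) = 0"
      using 0 by (simp add: zero_opp_def)
    moreover have "\<forall>c \<in> B \<rightarrow> L. (\<Sum>b\<in>B. b * c b) = 0 \<longrightarrow> (\<forall>b\<in>B. c b = 0)"
      using assms by (simp add: right_basis_def)
    ultimately have "\<forall>b\<in>B. unopp (c (Opp b)) = 0"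
      by (auto dest: bspec[of _ _ "\<lambda>b. unopp (c (Opp b))"])
    with b show "c b = 0" by (auto simp: zero_opp_def eq_Opp_iff)
  qed
qed

lemma right_dimension_Opp: "right_dimension L d \<Longrightarrow> left_dimension (Opp ` L) d"
  unfolding right_dimension_def left_dimension_def
  by (metis card_image inj_Opp inj_on_subset right_basis_Opp subset_UNIV)

theorem theorem3p3:
  fixes K L :: "'a::division_ring set" and g :: "nat \<Rightarrow> 'a" and m d :: nat
  assumes "central_subfield K"
    and "skew_subfield L" and "K \<subseteq> L"
    and "skew_generates K (g ` {..<m}) UNIV"
    and "left_dimension L d \<or> right_dimension L d"
  shows "\<exists>T. finite T \<and> int (card T) \<le> (int d)\<^sup>2 * (int m - 1) + int d \<and> skew_generates K T L"
  using assms(5)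
proof
  assume "left_dimension L d"
  with assms(1-4) show ?thesis by (rule left_dimension_generators)
next
  assume "right_dimension L d"
  \<comment> \<open>The left case is applied in the opposite skew field, and its generators are
    pulled back along \<open>unopp\<close>.\<close>
  then have dim: "left_dimension (Opp ` L) d" by (rule right_dimension_Opp)
  have surj: "Opp ` (UNIV :: 'a set) = UNIV" by (auto simp: Opp_image_iff)
  have "skew_generates (Opp ` K) ((Opp \<circ> g) ` {..<m}) UNIV"
    using assms(4) skew_generates_Opp[of K "g ` {..<m}" UNIV] by (simp add: surj image_comp)
  then obtain T where T: "finite T" "int (card T) \<le> (int d)\<^sup>2 * (int m - 1) + int d"
    "skew_generates (Opp ` K) T (Opp ` L)"
    using left_dimension_generators[OF central_subfield_Opp[OF assms(1)] _ _ _ dim] assms(2,3)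
    by (metis image_mono skew_subfield_Opp)
  have "skew_generates K (unopp ` T) L"
    using T(3) skew_generates_Opp[of K "unopp ` T" L] by (simp only: Opp_image_unopp)
  moreover have "card (unopp ` T) \<le> card T"
    using T(1) by (rule card_image_le)
  ultimately show ?thesis
    using T(1,2) by (intro exI[of _ "unopp ` T"]) auto
qed

end
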